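(* For every state $\rho^{AB}$ on a finite-dimensional bipartite Hilbert space $\mathcal{H}_A\otimes\mathcal{H}_B$, the squashed entanglement is upper bounded by the entanglement of formation: $$E_{sq}(\rho^{AB})\le E_F(\rho^{AB}).$$
   Context: All Hilbert spaces are finite dimensional. For a state $\rho$ on a tensor product of systems, $\rho^X$ denotes its reduced state on the subsystem $X$, and $S(X)=S(\rho^X)=-\operatorname{Tr}\rho^X\log\rho^X$ is the von Neumann entropy ($\log$ to base 2). For a tripartite state $\rho^{ABE}$ the quantum conditional mutual information is $I(A;B|E)=S(AE)+S(BE)-S(ABE)-S(E)$. The squashed entanglement of a state $\rho^{AB}$ on $\mathcal{H}_A\otimes\mathcal{H}_B$ is $$E_{sq}(\rho^{AB})=\inf\left\{\tfrac12 I(A;B|E)\;:\;\rho^{ABE}\text{ a state on }\mathcal{H}_A\otimes\mathcal{H}_B\otimes\mathcal{H}_E\text{ with }\operatorname{Tr}_E\rho^{ABE}=\rho^{AB}\right\},$$ where the infimum is over all extensions $\rho^{ABE}$, with $\mathcal{H}_E$ of arbitrary (a priori unbounded) finite dimension. The entanglement of formation is $E_F(\rho^{AB})=\inf\sum_k p_k\,S(A)_{\Psi_k}$, the infimum being over all finite pure-state ensembles $\{p_k,|\Psi_k\rangle\}$ with $\sum_k p_k|\Psi_k\rangle\langle\Psi_k|=\rho^{AB}$, where $S(A)_{\Psi_k}$ is the von Neumann entropy of $\operatorname{Tr}_B|\Psi_k\rangle\langle\Psi_k|$. *)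

theory Defs
  imports "HOL-Library.Extended_Real" "Jordan_Normal_Form.Schur_Decomposition"
begin

text \<open>
  Finite-dimensional Hilbert spaces are taken in coordinates with respect to an orthonormal basis:
  a space of dimension \<open>n\<close> is \<open>\<complex>\<^sup>n\<close>, and its operators are the complex \<open>n \<times> n\<close> matrices.
  The product basis of \<open>\<complex>\<^sup>m \<otimes> \<complex>\<^sup>n\<close> is ordered lexicographically, so that
  \<open>e\<^sub>i \<otimes> e\<^sub>j\<close> has index \<open>i * n + j\<close>; under this convention the tensor product is associative.
\<close>

definition mat_trace :: "complex mat \<Rightarrow> complex" where
  "mat_trace A = (\<Sum>i<dim_row A. A $$ (i, i))"

definition is_unitary :: "nat \<Rightarrow> complex mat \<Rightarrow> bool" where
  "is_unitary n U \<longleftrightarrow> U \<in> carrier_mat n n \<and> mat_adjoint U * U = 1\<^sub>m n \<and> U * mat_adjoint U = 1\<^sub>m n"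

text \<open>
  In the next definition \<open>0 \<le> z\<close> for complex \<open>z\<close> means that \<open>z\<close> is real and nonnegative, and
  \<open>w \<bullet>c v\<close> is conjugate-linear in \<open>v\<close>. The trace condition excludes \<open>n = 0\<close>.
\<close>

definition is_state :: "nat \<Rightarrow> complex mat \<Rightarrow> bool" where
  "is_state n \<rho> \<longleftrightarrow> \<rho> \<in> carrier_mat n n \<and> mat_adjoint \<rho> = \<rho> \<and>
     (\<forall>v\<in>carrier_vec n. 0 \<le> (\<rho> *\<^sub>v v) \<bullet>c v) \<and> mat_trace \<rho> = 1"

text \<open>
  Functional calculus for a Hermitian matrix: \<open>f\<close> is applied to the eigenvalues in any unitary
  diagonalization \<open>A = U diag(d) U\<^sup>*\<close>; the result does not depend on the diagonalization chosen.
\<close>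

definition hermitian_fun :: "(real \<Rightarrow> real) \<Rightarrow> complex mat \<Rightarrow> complex mat" where
  "hermitian_fun f A = (THE B. \<exists>U (d :: nat \<Rightarrow> real).
     is_unitary (dim_row A) U \<and>
     A = U * mat_diag (dim_row A) (\<lambda>i. complex_of_real (d i)) * mat_adjoint U \<and>
     B = U * mat_diag (dim_row A) (\<lambda>i. complex_of_real (f (d i))) * mat_adjoint U)"

text \<open>
  The convention \<open>0 log 0 = 0\<close> holds because \<open>log 2 0\<close> is a real number
  (in fact \<open>0\<close>), which gets multiplied by the eigenvalue \<open>0\<close> of \<open>\<rho>\<close>.
\<close>

definition vn_entropy :: "complex mat \<Rightarrow> real" where
  "vn_entropy \<rho> = - Re (mat_trace (\<rho> * hermitian_fun (log 2) \<rho>))"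

text \<open>
  The partial trace over the middle factor of \<open>\<complex>\<^sup>l \<otimes> \<complex>\<^sup>m \<otimes> \<complex>\<^sup>r\<close>. Taking \<open>r = 1\<close> or \<open>l = 1\<close>
  gives the partial trace over the right or left factor of a bipartite space.
\<close>

definition ptrace :: "nat \<Rightarrow> nat \<Rightarrow> nat \<Rightarrow> complex mat \<Rightarrow> complex mat" where
  "ptrace l m r M = mat (l * r) (l * r) (\<lambda>(s, t).
     \<Sum>j<m. M $$ ((s div r * m + j) * r + s mod r, (t div r * m + j) * r + t mod r))"

text \<open>
  \<open>I(A;B|E)\<close> for a state on \<open>\<complex>\<^sup>a \<otimes> \<complex>\<^sup>b \<otimes> \<complex>\<^sup>e\<close>; the terms are \<open>S(AE)\<close>, \<open>S(BE)\<close>, \<open>S(ABE)\<close>, \<open>S(E)\<close>.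
\<close>

definition cond_mutual_info :: "nat \<Rightarrow> nat \<Rightarrow> nat \<Rightarrow> complex mat \<Rightarrow> real" where
  "cond_mutual_info a b e \<rho> =
     vn_entropy (ptrace a b e \<rho>) + vn_entropy (ptrace 1 a (b * e) \<rho>)
     - vn_entropy \<rho> - vn_entropy (ptrace 1 (a * b) e \<rho>)"

text \<open>
  The infima are taken in the extended reals, where every set has a genuine infimum.
\<close>

definition squashed_entanglement :: "nat \<Rightarrow> nat \<Rightarrow> complex mat \<Rightarrow> ereal" where
  "squashed_entanglement a b \<rho> =
     Inf {ereal (1 / 2 * cond_mutual_info a b e \<sigma>) | e \<sigma>.
       is_state (a * b * e) \<sigma> \<and> ptrace (a * b) e 1 \<sigma> = \<rho>}"

definition ket_bra :: "complex vec \<Rightarrow> complex mat" where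
  "ket_bra v = mat (dim_vec v) (dim_vec v) (\<lambda>(i, j). v $ i * cnj (v $ j))"

definition is_pure_ensemble ::
  "nat \<Rightarrow> nat \<Rightarrow> (nat \<Rightarrow> real) \<Rightarrow> (nat \<Rightarrow> complex vec) \<Rightarrow> complex mat \<Rightarrow> bool" where
  "is_pure_ensemble n N p \<Psi> \<rho> \<longleftrightarrow>
     (\<forall>k<N. 0 \<le> p k \<and> \<Psi> k \<in> carrier_vec n \<and> \<Psi> k \<bullet>c \<Psi> k = 1) \<and> (\<Sum>k<N. p k) = 1 \<and>
     mat n n (\<lambda>ij. \<Sum>k<N. complex_of_real (p k) * ket_bra (\<Psi> k) $$ ij) = \<rho>"

definition entanglement_of_formation :: "nat \<Rightarrow> nat \<Rightarrow> complex mat \<Rightarrow> ereal" where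
  "entanglement_of_formation a b \<rho> =
     Inf {ereal (\<Sum>k<N. p k * vn_entropy (ptrace a b 1 (ket_bra (\<Psi> k)))) | N p \<Psi>.
       is_pure_ensemble (a * b) N p \<Psi> \<rho>}"

end

theory Submission
  imports Defs "HOL-Computational_Algebra.Fundamental_Theorem_Algebra"
begin

text \<open>
  An ensemble \<open>p\<^sub>k, \<Psi>\<^sub>k\<close> for \<open>\<rho>\<close> yields the extension \<open>\<Sum>\<^sub>k p\<^sub>k |\<Psi>\<^sub>k\<rangle>\<langle>\<Psi>\<^sub>k| \<otimes> |k\<rangle>\<langle>k|\<close>, in which \<open>E\<close> is a classical
  register. Each of the four entropies in \<open>I(A;B|E)\<close> is the Shannon entropy of \<open>p\<close> plus the average
  over \<open>k\<close> of the corresponding entropy of \<open>\<Psi>\<^sub>k\<close>; the Shannon terms cancel, and as \<open>\<Psi>\<^sub>k\<close> is pure,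
  \<open>S(AB) = 0\<close> and \<open>S(A) = S(B)\<close>, so \<open>I(A;B|E) / 2\<close> is the average entanglement entropy.

  The entropies are computed through intertwiners: if \<open>A M = M B\<close> with \<open>A\<close> and \<open>B\<close> Hermitian, then
  \<open>f(A) M = M f(B)\<close>.
\<close>

subsection \<open>Diagonalization of Hermitian matrices\<close>

lemma dim_mat_adjoint [simp]:
  "dim_row (mat_adjoint A) = dim_col A" "dim_col (mat_adjoint A) = dim_row A"
  by (simp_all add: mat_adjoint_def)

lemma mat_adjoint_carrier [simp]:
  "A \<in> carrier_mat n m \<Longrightarrow> mat_adjoint A \<in> carrier_mat m n"
  by (metis carrier_matD carrier_matI dim_mat_adjoint)

lemma mat_adjoint_index [simp]:
  fixes A :: "complex mat"
  shows "i < dim_col A \<Longrightarrow> j < dim_row A \<Longrightarrow> mat_adjoint A $$ (i, j) = cnj (A $$ (j, i))"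
  by (simp add: mat_adjoint_def mat_of_rows_def)

lemma mat_adjoint_adjoint [simp]:
  fixes A :: "complex mat"
  shows "mat_adjoint (mat_adjoint A) = A"
  by (rule eq_matI) auto

lemma mat_adjoint_mult:
  fixes A B :: "complex mat"
  assumes "A \<in> carrier_mat n m" "B \<in> carrier_mat m k"
  shows "mat_adjoint (A * B) = mat_adjoint B * mat_adjoint A"
  using assms by (intro eq_matI) (auto simp: scalar_prod_def mult.commute intro!: sum.cong)

lemma mult_mat_vec_cscalar_prod:
  fixes A :: "complex mat"
  assumes A: "A \<in> carrier_mat n m" and u: "u \<in> carrier_vec m" and v: "v \<in> carrier_vec n"
  shows "(A *\<^sub>v u) \<bullet>c v = u \<bullet>c (mat_adjoint A *\<^sub>v v)"
proof -
  have "(A *\<^sub>v u) \<bullet>c v = (\<Sum>i<n. \<Sum>j<m. A $$ (i, j) * u $ j * cnj (v $ i))"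
    using assms by (auto simp: scalar_prod_def sum_distrib_right lessThan_atLeast0)
  also have "\<dots> = (\<Sum>j<m. \<Sum>i<n. A $$ (i, j) * u $ j * cnj (v $ i))"
    by (rule sum.swap)
  also have "\<dots> = u \<bullet>c (mat_adjoint A *\<^sub>v v)"
    using assms by (auto simp: scalar_prod_def sum_distrib_left lessThan_atLeast0 ac_simps intro!: sum.cong)
  finally show ?thesis .
qed

text \<open>For square matrices a left inverse is also a right inverse, so one of the two unitarity
  equations yields the other.\<close>

lemma is_unitaryI:
  assumes "U \<in> carrier_mat n n" "mat_adjoint U * U = 1\<^sub>m n"
  shows "is_unitary n U"
  using assms mat_mult_left_right_inverse[OF mat_adjoint_carrier[OF assms(1)] assms(1)]
  by (simp add: is_unitary_def)

lemma is_unitaryD: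
  assumes "is_unitary n U"
  shows "U \<in> carrier_mat n n" "mat_adjoint U \<in> carrier_mat n n"
    "mat_adjoint U * U = 1\<^sub>m n" "U * mat_adjoint U = 1\<^sub>m n"
  using assms by (auto simp: is_unitary_def)

lemma is_unitary_one: "is_unitary n (1\<^sub>m n)"
  by (rule is_unitaryI) (auto intro!: eq_matI simp: scalar_prod_def if_distrib sum.delta cong: if_cong)

lemma is_unitary_mult:
  assumes U: "is_unitary n U" and V: "is_unitary n V"
  shows "is_unitary n (U * V)"
proof (rule is_unitaryI)
  note [simp] = is_unitaryD[OF U] is_unitaryD[OF V]
  show "U * V \<in> carrier_mat n n" by (simp add: mult_carrier_mat[of _ n n])
  have "mat_adjoint (U * V) * (U * V) = mat_adjoint V * (mat_adjoint U * U) * V"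
    by (simp only: mat_adjoint_mult[OF is_unitaryD(1)[OF U] is_unitaryD(1)[OF V]])
       (simp add: assoc_mult_mat[of _ n n _ n _ n] mult_carrier_mat[of _ n n] del: is_unitaryD(3)[OF U])
  then show "mat_adjoint (U * V) * (U * V) = 1\<^sub>m n"
    using is_unitaryD[OF U] is_unitaryD[OF V] by simp
qed

text \<open>Complete \<open>v\<close> to a basis, orthogonalize it by Gram-Schmidt, which keeps the
  first vector, and normalize the columns. The scalar \<open>c\<close> is there because
  \<open>v\<close> may have any nonzero length.\<close>

lemma unitary_with_first_col:
  assumes v: "v \<in> carrier_vec n" "v \<noteq> 0\<^sub>v n"
  obtains U c where "is_unitary n U" "col U 0 = c \<cdot>\<^sub>v v"
proof -
  interpret cof_vec_space n "TYPE(complex)" .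
  define b where "b = basis_completion v"
  define ws where "ws = gram_schmidt n b"
  note bc = basis_completion[OF v, folded b_def]
  have n: "n \<noteq> 0" using v by (metis eq_vecI carrier_vecD less_nat_zero_code zero_carrier_vec)
  with bc obtain vs where bv: "b = v # vs" by (cases b) auto
  from gram_schmidt_result[OF bc(2) bc(4) bc(5) ws_def]
  have ws: "set ws \<subseteq> carrier_vec n" "corthogonal ws" "length ws = n" by (auto simp: bc)
  from gram_schmidt_hd[OF v(1), of vs, folded bv] have hdws: "hd ws = v" unfolding ws_def .
  have ws0: "ws ! 0 = v" using hdws ws(3) n by (cases ws) auto
  have wsc: "ws ! i \<in> carrier_vec n" if "i < n" for i using ws that by auto
  \<comment> \<open>Gram-Schmidt delivers orthogonal vectors only; \<open>c i\<close> is the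
    reciprocal of the norm of \<open>ws ! i\<close>.\<close>
  define c where "c i = complex_of_real (1 / sqrt (Re (ws ! i \<bullet>c ws ! i)))" for i
  define U where "U = mat n n (\<lambda>(j, i). c i * ws ! i $ j)"
  have U: "U \<in> carrier_mat n n" by (simp add: U_def)
  have ent: "(mat_adjoint U * U) $$ (i, j) = cnj (c i) * c j * (ws ! j \<bullet>c ws ! i)"
    if "i < n" "j < n" for i j
    using that wsc[OF that(1)] wsc[OF that(2)]
    by (auto simp: U_def scalar_prod_def sum_distrib_left ac_simps intro!: sum.cong)
  have nrm: "cnj (c i) * c i * (ws ! i \<bullet>c ws ! i) = 1" if "i < n" for i
  proof -
    have "ws ! i \<bullet>c ws ! i \<noteq> 0" using corthogonalD[OF ws(2)] that ws by auto
    moreover have "ws ! i \<bullet>c ws ! i \<ge> 0" by auto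
    ultimately obtain r where r: "ws ! i \<bullet>c ws ! i = complex_of_real r" "r > 0"
      by (auto simp: less_eq_complex_def complex_eq_iff dest: order_le_imp_less_or_eq)
    then have "c i = complex_of_real (1 / sqrt r)" by (simp add: c_def)
    with r show ?thesis
      by (simp del: of_real_divide flip: of_real_mult)
  qed
  have "mat_adjoint U * U = 1\<^sub>m n"
    using U by (intro eq_matI) (auto simp: ent nrm corthogonalD[OF ws(2)] ws(3) simp del: index_mult_mat(1))
  then have "is_unitary n U" using U by (rule is_unitaryI[rotated])
  moreover have "col U 0 = c 0 \<cdot>\<^sub>v v"
    using ws0 n v by (intro eq_vecI) (auto simp: U_def)
  ultimately show thesis by (rule that)
qed

text \<open>The characteristic polynomial has degree \<open>n\<close>, hence is not constant and has
  a complex root by the fundamental theorem of algebra.\<close>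

lemma eigenvector_exists:
  fixes A :: "complex mat"
  assumes A: "A \<in> carrier_mat n n" and n: "n \<noteq> 0"
  obtains v e where "v \<in> carrier_vec n" "v \<noteq> 0\<^sub>v n" "A *\<^sub>v v = e \<cdot>\<^sub>v v"
proof -
  have "degree (char_poly A) = n" using degree_monic_char_poly[OF A] by simp
  then have "\<not> constant (poly (char_poly A))" using n by (simp add: constant_degree)
  then obtain e where "poly (char_poly A) e = 0" using fundamental_theorem_of_algebra by blast
  then obtain v where "eigenvector A v e"
    using eigenvalue_root_char_poly[OF A] by (auto simp: eigenvalue_def)
  then show thesis using that A by (auto simp: eigenvector_def)
qed

text \<open>Induction on the dimension. Conjugating by a unitary whose first column is an
  eigenvector clears the first column below the diagonal; being Hermitian, the matrix then also has
  a cleared first row, and the induction hypothesis diagonalizes the remaining block.\<close>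

theorem hermitian_diagonalization:
  assumes "A \<in> carrier_mat n n" "mat_adjoint A = A"
  obtains U and d :: "nat \<Rightarrow> real" where "is_unitary n U"
    "A = U * mat_diag n (\<lambda>i. complex_of_real (d i)) * mat_adjoint U"
  using assms
proof (induction n arbitrary: A thesis)
  case 0
  show ?case by (rule "0.prems"(1)[of "1\<^sub>m 0"]) (use 0 in \<open>auto intro: is_unitary_one\<close>)
next
  case (Suc n)
  let ?n = "Suc n"
  from Suc.prems have A: "A \<in> carrier_mat ?n ?n" and hA: "mat_adjoint A = A" by auto
  obtain v e where v: "v \<in> carrier_vec ?n" "v \<noteq> 0\<^sub>v ?n" "A *\<^sub>v v = e \<cdot>\<^sub>v v"
    using eigenvector_exists[OF A] by auto
  obtain U c where U: "is_unitary ?n U" and cU: "col U 0 = c \<cdot>\<^sub>v v"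
    using unitary_with_first_col[OF v(1,2)] by blast
  note Uc = is_unitaryD[OF U]
  define B where "B = mat_adjoint U * (A * U)"
  have B: "B \<in> carrier_mat ?n ?n" using Uc A by (simp add: B_def mult_carrier_mat[of _ ?n ?n])
  have hB: "mat_adjoint B = B"
    unfolding B_def using Uc A
    by (simp add: mat_adjoint_mult[of _ ?n ?n _ ?n] hA assoc_mult_mat[of _ ?n ?n _ ?n _ ?n] mult_carrier_mat[of _ ?n ?n])
  have AU: "col (A * U) 0 = e \<cdot>\<^sub>v col U 0"
    using v cU by (simp add: col_mult2[OF A Uc(1)] mult_mat_vec[OF A] smult_smult_assoc mult.commute )
  have "col B 0 = e \<cdot>\<^sub>v (mat_adjoint U *\<^sub>v col U 0)"
    using AU col_dim[of U 0] Uc(1)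
    by (simp add: B_def col_mult2[OF Uc(2) mult_carrier_mat[OF A Uc(1)]] mult_mat_vec[OF Uc(2)] carrier_dim_vec)
  also have "mat_adjoint U *\<^sub>v col U 0 = col (mat_adjoint U * U) 0"
    using col_mult2[OF Uc(2,1)] by simp
  finally have colB: "col B 0 = e \<cdot>\<^sub>v unit_vec ?n 0" using Uc(3) by simp
  have Bi0: "B $$ (i, 0) = (if i = 0 then e else 0)" if "i < ?n" for i
    using arg_cong[OF colB, of "\<lambda>w. w $ i"] that B by auto
  have sym: "B $$ (i, j) = cnj (B $$ (j, i))" if "i < ?n" "j < ?n" for i j
    using arg_cong[OF hB, of "\<lambda>M. M $$ (i, j)"] that B by auto
  \<comment> \<open>Hermitian symmetry carries the zeros of the first column over to the first
    row.\<close>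
  have B0i: "B $$ (0, i) = (if i = 0 then e else 0)" if "i < ?n" for i
    using sym[of 0 i] sym[of 0 0] Bi0[of i] Bi0[of 0] that by auto
  \<comment> \<open>The eigenvalue is a diagonal entry of a Hermitian matrix, hence real.\<close>
  have re: "e = complex_of_real (Re e)"
    using sym[of 0 0] Bi0[of 0] by (simp add: complex_eq_iff)
  define C where "C = mat n n (\<lambda>(i, j). B $$ (Suc i, Suc j))"
  have C: "C \<in> carrier_mat n n" by (simp add: C_def)
  have "mat_adjoint C = C"
    by (rule eq_matI) (auto simp: C_def sym[symmetric])
  then obtain V d where V: "is_unitary n V"
    and Cd: "C = V * mat_diag n (\<lambda>i. complex_of_real (d i)) * mat_adjoint V"
    using Suc.IH[OF _ C] by blast
  note Vc = is_unitaryD[OF V]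
  \<comment> \<open>\<open>F a X\<close> is the direct sum of the scalar \<open>a\<close> and the
    block \<open>X\<close>. It respects products, adjoints and the identity, so a unitary
    \<open>V\<close> extends to the unitary \<open>F 1 V\<close>.\<close>
  define F where "F a X = four_block_mat (a \<cdot>\<^sub>m 1\<^sub>m 1) (0\<^sub>m 1 n) (0\<^sub>m n 1) X" for a :: complex and X
  have F: "F a X \<in> carrier_mat ?n ?n" if "X \<in> carrier_mat n n" for a :: complex and X
    using that four_block_carrier_mat[of "a \<cdot>\<^sub>m 1\<^sub>m 1" 1 1 X n n] by (simp add: F_def)
  have m1: "(a \<cdot>\<^sub>m 1\<^sub>m 1) * (b \<cdot>\<^sub>m 1\<^sub>m 1) = (a * b) \<cdot>\<^sub>m 1\<^sub>m 1" for a b :: complex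
    by (rule eq_matI) (auto simp: scalar_prod_def)
  have Fm: "F a X * F b Y = F (a * b) (X * Y)"
    if "X \<in> carrier_mat n n" "Y \<in> carrier_mat n n" for a b :: complex and X Y
    unfolding F_def using that by (subst mult_four_block_mat[of _ 1 1 _ n _ n _ _ 1 _ n]) (simp_all add: m1[unfolded One_nat_def])
  have Fa: "mat_adjoint (F a X) = F (cnj a) (mat_adjoint X)"
    if "X \<in> carrier_mat n n" for a X
    using that by (intro eq_matI) (auto simp: F_def)
  have F1: "F 1 (1\<^sub>m n) = 1\<^sub>m ?n" by (rule eq_matI) (auto simp: F_def)
  define W where "W = F 1 V"
  have W: "is_unitary ?n W"
    by (rule is_unitaryI) (use Vc in \<open>simp_all add: W_def F Fa Fm F1\<close>)
  note Wc = is_unitaryD[OF W]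
  define d' where "d' i = (case i of 0 \<Rightarrow> Re e | Suc j \<Rightarrow> d j)" for i
  let ?D = "mat_diag ?n (\<lambda>i. complex_of_real (d' i))"
  have D': "?D = F e (mat_diag n (\<lambda>i. complex_of_real (d i)))"
    using re by (intro eq_matI) (auto simp: F_def mat_diag_def d'_def split: nat.splits)
  have "B = F e C"
    using B by (intro eq_matI) (auto simp: F_def C_def Bi0 B0i)
  also have "\<dots> = W * ?D * mat_adjoint W"
    using Vc unfolding D' W_def Cd by (simp add: Fa Fm)
  finally have BW: "B = W * ?D * mat_adjoint W" .
  have D: "?D \<in> carrier_mat ?n ?n" by simp
  \<comment> \<open>Undo the conjugation that defines \<open>B\<close>; the diagonalizing unitary of
    \<open>A\<close> is then \<open>U * W\<close>.\<close>
  have "A = (U * mat_adjoint U) * A * (U * mat_adjoint U)"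
    using Uc A by simp
  also have "\<dots> = U * B * mat_adjoint U"
    unfolding B_def using Uc(1,2) A by (simp add: assoc_mult_mat[of _ ?n ?n _ ?n _ ?n] mult_carrier_mat[of _ ?n ?n])
  also have "\<dots> = (U * W) * ?D * mat_adjoint (U * W)"
    unfolding BW mat_adjoint_mult[OF Uc(1) Wc(1)] using Uc(1,2) Wc(1,2) D
    by (simp add: assoc_mult_mat[of _ ?n ?n _ ?n _ ?n] mult_carrier_mat[of _ ?n ?n])
  finally show ?case by (rule Suc.prems(1)[OF is_unitary_mult[OF U W]])
qed

subsection \<open>Functional calculus and entropy\<close>

lemma mat_trace_mult_comm:
  assumes "A \<in> carrier_mat n m" "B \<in> carrier_mat m n"
  shows "mat_trace (A * B) = mat_trace (B * A)"
proof -
  have "mat_trace (A * B) = (\<Sum>i<n. \<Sum>j<m. A $$ (i, j) * B $$ (j, i))"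
    using assms by (auto simp: mat_trace_def scalar_prod_def lessThan_atLeast0)
  also have "\<dots> = (\<Sum>j<m. \<Sum>i<n. A $$ (i, j) * B $$ (j, i))"
    by (rule sum.swap)
  also have "\<dots> = mat_trace (B * A)"
    using assms by (auto simp: mat_trace_def scalar_prod_def lessThan_atLeast0 mult.commute)
  finally show ?thesis .
qed

text \<open>Written in the two eigenbases, \<open>M\<close> becomes \<open>W\<close>, and the
  intertwining relation says \<open>d i * W(i,j) = W(i,j) * d' j\<close> entrywise. Thus
  \<open>W(i,j)\<close> vanishes unless \<open>d i = d' j\<close>, and the same relation follows
  with \<open>f (d i)\<close> and \<open>f (d' j)\<close>.\<close>

lemma diagonalized_fun_intertwine:
  fixes d d' :: "nat \<Rightarrow> real"
  assumes U: "is_unitary n U" and V: "is_unitary m V" and M: "M \<in> carrier_mat n m"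
    and A: "A = U * mat_diag n (\<lambda>i. complex_of_real (d i)) * mat_adjoint U"
    and B: "B = V * mat_diag m (\<lambda>i. complex_of_real (d' i)) * mat_adjoint V"
    and AM: "A * M = M * B"
  shows "(U * mat_diag n (\<lambda>i. complex_of_real (f (d i))) * mat_adjoint U) * M =
    M * (V * mat_diag m (\<lambda>i. complex_of_real (f (d' i))) * mat_adjoint V)"
proof -
  note Uc = is_unitaryD[OF U] and Vc = is_unitaryD[OF V]
  note assoc = assoc_mult_mat[of _ n n _ n _ n] assoc_mult_mat[of _ n n _ n _ m]
    assoc_mult_mat[of _ n n _ m _ m] assoc_mult_mat[of _ n m _ m _ m] assoc_mult_mat[of _ m m _ m _ m]
    mult_carrier_mat[of _ n n _ n] mult_carrier_mat[of _ n n _ m]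
    mult_carrier_mat[of _ n m _ m] mult_carrier_mat[of _ m m _ m]
  define W where "W = mat_adjoint U * M * V"
  have W: "W \<in> carrier_mat n m" using Uc Vc M by (simp add: W_def assoc)
  have UW: "U * W = M * V"
  proof -
    have "U * W = (U * mat_adjoint U) * (M * V)"
      using Uc(1,2) Vc(1,2) M by (simp add: W_def assoc)
    then show ?thesis using Uc Vc M by (simp add: assoc)
  qed
  have WV: "W * mat_adjoint V = mat_adjoint U * M"
  proof -
    have "W * mat_adjoint V = mat_adjoint U * M * (V * mat_adjoint V)"
      using Uc(1,2) Vc(1,2) M by (simp add: W_def assoc)
    then show ?thesis using Uc Vc M by (simp add: assoc)
  qed
  let ?D = "\<lambda>g. mat_diag n (\<lambda>i. complex_of_real (g (d i)))"
  let ?D' = "\<lambda>g. mat_diag m (\<lambda>i. complex_of_real (g (d' i)))"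
  have D: "?D g \<in> carrier_mat n n" "?D' g \<in> carrier_mat m m" for g by simp_all
  have "?D id * W = (mat_adjoint U * U) * ?D id * (mat_adjoint U * M * V)"
    using Uc(3) left_mult_one_mat[OF D(1)[of id]] by (simp add: W_def)
  also have "\<dots> = mat_adjoint U * (A * M) * V"
    using Uc(1,2) Vc(1,2) M D[of id] unfolding A by (simp add: assoc)
  also have "\<dots> = mat_adjoint U * M * V * ?D' id * (mat_adjoint V * V)"
    using Uc(1,2) Vc(1,2) M D[of id] unfolding AM B by (simp add: assoc)
  also have "\<dots> = W * ?D' id"
    using Uc(2) Vc M right_mult_one_mat[OF D(2)[of id]] by (simp add: W_def assoc)
  finally have eq: "?D id * W = W * ?D' id" .
  have ent: "complex_of_real (d i) * W $$ (i, j) = W $$ (i, j) * complex_of_real (d' j)"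
    if "i < n" "j < m" for i j
    using arg_cong[OF eq, of "\<lambda>X. X $$ (i, j)"] that W
    by (simp add: mat_diag_mult_left[OF W] mat_diag_mult_right[OF W])
  have eqf: "?D f * W = W * ?D' f"
  proof (rule eq_matI, goal_cases)
    case (1 i j)
    then have "i < n" "j < m" using W by (auto simp: mat_diag_def)
    \<comment> \<open>A nonzero entry can be cancelled in \<open>ent\<close>, giving
      \<open>d i = d' j\<close>; at a zero entry both sides are 0.\<close>
    with ent[of i j] show ?case
      by (cases "W $$ (i, j) = 0") (auto simp: mat_diag_mult_left[OF W] mat_diag_mult_right[OF W])
  qed (use W in \<open>auto simp: mat_diag_def\<close>)
  have "(U * ?D f * mat_adjoint U) * M = U * (?D f * W) * mat_adjoint V"
    using Uc(1,2) Vc(1,2) W M D[of f] WV by (simp add: assoc)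
  also have "\<dots> = M * (V * ?D' f * mat_adjoint V)"
    unfolding eqf using Uc(1,2) Vc(1,2) W M D[of f] 
    by (simp add: assoc UW flip: assoc_mult_mat[of U n n W m _ m])
  finally show ?thesis .
qed

text \<open>Makes the definite description usable. The identity intertwines \<open>A\<close> with
  itself, so by \<open>diagonalized_fun_intertwine\<close> any two diagonalizations of
  \<open>A\<close> produce the same matrix.\<close>

lemma hermitian_fun_diag:
  fixes d :: "nat \<Rightarrow> real"
  assumes U: "is_unitary n U" and A: "A = U * mat_diag n (\<lambda>i. complex_of_real (d i)) * mat_adjoint U"
  shows "hermitian_fun f A = U * mat_diag n (\<lambda>i. complex_of_real (f (d i))) * mat_adjoint U"
proof -
  have Ac: "A \<in> carrier_mat n n"
    using is_unitaryD[OF U] unfolding A by (simp add: mult_carrier_mat[of _ n n])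
  have dim: "dim_row A = n" using Ac by simp
  show ?thesis
    unfolding hermitian_fun_def dim
  proof (rule the_equality, goal_cases)
    case 1
    then show ?case using U A by blast
  next
    case (2 B)
    then obtain V d' where V: "is_unitary n V"
      and AV: "A = V * mat_diag n (\<lambda>i. complex_of_real (d' i)) * mat_adjoint V"
      and B: "B = V * mat_diag n (\<lambda>i. complex_of_real (f (d' i))) * mat_adjoint V" by blast
    have "B * 1\<^sub>m n = 1\<^sub>m n * (U * mat_diag n (\<lambda>i. complex_of_real (f (d i))) * mat_adjoint U)"
      unfolding B
      by (rule diagonalized_fun_intertwine[OF V U _ AV A]) (use Ac in auto)
    then show ?case
      using is_unitaryD[OF U] is_unitaryD[OF V] unfolding B by (simp add: mult_carrier_mat[of _ n n])
  qed
qed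

lemma hermitian_fun_carrier:
  assumes "A \<in> carrier_mat n n" "mat_adjoint A = A"
  shows "hermitian_fun f A \<in> carrier_mat n n"
proof -
  obtain U d where U: "is_unitary n U"
    and A: "A = U * mat_diag n (\<lambda>i. complex_of_real (d i)) * mat_adjoint U"
    using hermitian_diagonalization[OF assms] by blast
  show ?thesis using is_unitaryD[OF U] by (simp add: hermitian_fun_diag[OF U A] mult_carrier_mat[of _ n n])
qed

lemma hermitian_fun_intertwine:
  assumes A: "A \<in> carrier_mat n n" "mat_adjoint A = A"
    and B: "B \<in> carrier_mat m m" "mat_adjoint B = B"
    and M: "M \<in> carrier_mat n m" and AM: "A * M = M * B"
  shows "hermitian_fun f A * M = M * hermitian_fun f B"
proof -
  obtain U d where U: "is_unitary n U"
    and AU: "A = U * mat_diag n (\<lambda>i. complex_of_real (d i)) * mat_adjoint U"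
    using hermitian_diagonalization[OF A] by blast
  obtain V d' where V: "is_unitary m V"
    and BV: "B = V * mat_diag m (\<lambda>i. complex_of_real (d' i)) * mat_adjoint V"
    using hermitian_diagonalization[OF B] by blast
  show ?thesis
    unfolding hermitian_fun_diag[OF U AU] hermitian_fun_diag[OF V BV]
    by (rule diagonalized_fun_intertwine[OF U V M AU BV AM])
qed

lemma mat_trace_conj:
  assumes U: "is_unitary n U" and X: "X \<in> carrier_mat n n"
  shows "mat_trace (U * X * mat_adjoint U) = mat_trace X"
proof -
  note Uc = is_unitaryD[OF U]
  have "mat_trace (U * (X * mat_adjoint U)) = mat_trace ((X * mat_adjoint U) * U)"
    using Uc X by (intro mat_trace_mult_comm) (auto intro: mult_carrier_mat[of _ n n])
  also have "(X * mat_adjoint U) * U = X"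
    using Uc X by (simp add: assoc_mult_mat[of _ n n _ n _ n])
  finally show ?thesis using Uc X by (simp add: assoc_mult_mat[of _ n n _ n _ n])
qed

lemma vn_entropy_diag:
  fixes d :: "nat \<Rightarrow> real"
  assumes U: "is_unitary n U" and A: "A = U * mat_diag n (\<lambda>i. complex_of_real (d i)) * mat_adjoint U"
  shows "vn_entropy A = - (\<Sum>i<n. d i * log 2 (d i))"
proof -
  note Uc = is_unitaryD[OF U]
  let ?D = "\<lambda>g. mat_diag n (\<lambda>i. complex_of_real (g (d i)))"
  have D: "?D g \<in> carrier_mat n n" for g by simp
  have "A * hermitian_fun (log 2) A = U * (?D id * ((mat_adjoint U * U) * ?D (log 2))) * mat_adjoint U"
    unfolding hermitian_fun_diag[OF U A] unfolding A using Uc(1,2) D[of id] D[of "log 2"]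
    by (simp add: assoc_mult_mat[of _ n n _ n _ n] mult_carrier_mat[of _ n n])
  also have "\<dots> = U * mat_diag n (\<lambda>i. complex_of_real (d i * log 2 (d i))) * mat_adjoint U"
    using Uc(3) left_mult_one_mat[OF D[of "log 2"]] by simp
  finally show ?thesis
    unfolding vn_entropy_def by (simp add: mat_trace_conj[OF U]) (simp add: mat_trace_def mat_diag_def)
qed

text \<open>Scaling multiplies every eigenvalue by \<open>p\<close>, and the logarithm of the
  product splits. For a matrix of trace 1 the extra term is \<open>- p * log 2 p\<close>, the share
  of the weight \<open>p\<close> in a Shannon entropy.\<close>

lemma vn_entropy_smult:
  assumes A: "A \<in> carrier_mat n n" "mat_adjoint A = A"
  shows "vn_entropy (complex_of_real p \<cdot>\<^sub>m A) = p * vn_entropy A - p * log 2 p * Re (mat_trace A)"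
proof -
  obtain U d where U: "is_unitary n U"
    and AU: "A = U * mat_diag n (\<lambda>i. complex_of_real (d i)) * mat_adjoint U"
    using hermitian_diagonalization[OF A] by blast
  note Uc = is_unitaryD[OF U]
  let ?D = "mat_diag n (\<lambda>i. complex_of_real (d i))"
  have D: "?D \<in> carrier_mat n n" by simp
  have "complex_of_real p \<cdot>\<^sub>m ?D = mat_diag n (\<lambda>i. complex_of_real (p * d i))"
    by (rule eq_matI) (auto simp: mat_diag_def)
  then have "complex_of_real p \<cdot>\<^sub>m A = U * mat_diag n (\<lambda>i. complex_of_real (p * d i)) * mat_adjoint U"
    unfolding AU using Uc D
    by (simp add: mult_smult_assoc_mat[of _ n n _ n] mult_smult_distrib[of _ n n _ n] mult_carrier_mat[of _ n n]
        flip: \<open>complex_of_real p \<cdot>\<^sub>m ?D = _\<close> del: of_real_mult)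
  then have "vn_entropy (complex_of_real p \<cdot>\<^sub>m A) = - (\<Sum>i<n. (p * d i) * log 2 (p * d i))"
    by (rule vn_entropy_diag[OF U])
  \<comment> \<open>If \<open>p\<close> or \<open>d i\<close> is 0, both summands are 0; otherwise
    the logarithm is additive.\<close>
  also have "(\<Sum>i<n. (p * d i) * log 2 (p * d i)) = (\<Sum>i<n. p * (d i * log 2 (d i)) + p * log 2 p * d i)"
    by (rule sum.cong) (auto simp: log_mult algebra_simps)
  also have "\<dots> = p * (\<Sum>i<n. d i * log 2 (d i)) + p * log 2 p * (\<Sum>i<n. d i)"
    by (simp add: sum.distrib sum_distrib_left)
  also have "(\<Sum>i<n. d i) = Re (mat_trace A)"
    unfolding AU by (simp add: mat_trace_conj[OF U]) (simp add: mat_trace_def mat_diag_def)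
  finally show ?thesis by (simp add: vn_entropy_diag[OF U AU])
qed

text \<open>The entrywise conjugate of \<open>U\<close> diagonalizes the transpose with the same
  eigenvalues. The transpose arises in the left partial trace of a pure state.\<close>

lemma vn_entropy_transpose:
  assumes A: "A \<in> carrier_mat n n" "mat_adjoint A = A"
  shows "vn_entropy (transpose_mat A) = vn_entropy A"
proof -
  obtain U d where U: "is_unitary n U"
    and AU: "A = U * mat_diag n (\<lambda>i. complex_of_real (d i)) * mat_adjoint U"
    using hermitian_diagonalization[OF A] by blast
  note Uc = is_unitaryD[OF U]
  let ?D = "mat_diag n (\<lambda>i. complex_of_real (d i))"
  let ?V = "transpose_mat (mat_adjoint U)"
  have D: "?D \<in> carrier_mat n n" by simp
  have V: "?V \<in> carrier_mat n n" using Uc by simp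
  have aV: "mat_adjoint ?V = transpose_mat U" by (rule eq_matI) auto
  have "mat_adjoint ?V * ?V = transpose_mat (mat_adjoint U * U)"
    using Uc(1,2) by (simp add: aV transpose_mult[of _ n n _ n])
  then have uV: "is_unitary n ?V" using V Uc by (intro is_unitaryI) simp_all
  have "transpose_mat ?D = ?D" by (rule eq_matI) (auto simp: mat_diag_def)
  then have "transpose_mat A = ?V * ?D * mat_adjoint ?V"
    unfolding AU aV using Uc(1,2) D
    by (simp add: transpose_mult[of _ n n _ n] mult_carrier_mat[of _ n n] assoc_mult_mat[of _ n n _ n _ n])
  then show ?thesis by (simp add: vn_entropy_diag[OF uV] vn_entropy_diag[OF U AU])
qed

lemma adjoint_mult_self_hermitian:
  fixes M :: "complex mat"
  assumes M: "M \<in> carrier_mat n m"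
  shows "mat_adjoint (M * mat_adjoint M) = M * mat_adjoint M"
  using mat_adjoint_mult[OF M mat_adjoint_carrier[OF M]] by simp

text \<open>
  Since \<open>M\<close> intertwines \<open>M\<^sup>* M\<close> and \<open>M M\<^sup>*\<close>, it intertwines their functional calculi as well; this
  replaces the singular value decomposition.
\<close>

lemma vn_entropy_mult_adjoint:
  assumes M: "M \<in> carrier_mat n m"
  shows "vn_entropy (M * mat_adjoint M) = vn_entropy (mat_adjoint M * M)"
proof -
  let ?A = "M * mat_adjoint M" and ?B = "mat_adjoint M * M" and ?f = "hermitian_fun (log 2)"
  have Ms: "mat_adjoint M \<in> carrier_mat m n" using M by simp
  have A: "?A \<in> carrier_mat n n" "mat_adjoint ?A = ?A"
    using mult_carrier_mat[OF M Ms] adjoint_mult_self_hermitian[OF M] by auto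
  have B: "?B \<in> carrier_mat m m" "mat_adjoint ?B = ?B"
    using mult_carrier_mat[OF Ms M] adjoint_mult_self_hermitian[OF Ms] by auto
  note fA = hermitian_fun_carrier[OF A, of "log 2"] and fB = hermitian_fun_carrier[OF B, of "log 2"]
  have int: "?f ?A * M = M * ?f ?B"
    by (rule hermitian_fun_intertwine[OF A B M assoc_mult_mat[OF M Ms M]])
  \<comment> \<open>Cyclicity brings \<open>?f ?A\<close> next to \<open>M\<close>, the intertwining
    relation replaces it by \<open>?f ?B\<close>, and cyclicity closes the circle.\<close>
  have "mat_trace (?A * ?f ?A) = mat_trace (?f ?A * M * mat_adjoint M)"
    using mat_trace_mult_comm[OF A(1) fA] assoc_mult_mat[OF fA M Ms] by simp
  also have "\<dots> = mat_trace (mat_adjoint M * (M * ?f ?B))"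
    unfolding int by (rule mat_trace_mult_comm[OF mult_carrier_mat[OF M fB] Ms])
  also have "\<dots> = mat_trace (?B * ?f ?B)"
    using assoc_mult_mat[OF Ms M fB] by simp
  finally show ?thesis by (simp add: vn_entropy_def)
qed

subsection \<open>States with a classical register\<close>

lemma block_index_less:
  fixes i j m n :: nat
  assumes "i < m" "j < n"
  shows "i * n + j < m * n"
proof -
  have "i * n + j < Suc i * n" using assms(2) by simp
  also have "\<dots> \<le> m * n" using assms(1) by (intro mult_le_mono1) simp
  finally show ?thesis .
qed

lemma block_index_div_mod:
  fixes s m n :: nat
  assumes "s < m * n"
  shows "s div n < m" "s mod n < n"
  using assms by (cases "n = 0"; auto simp: less_mult_imp_div_less)+

lemma sum_block_index:
  fixes f :: "nat \<Rightarrow> 'a :: comm_monoid_add"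
  shows "(\<Sum>s<m * n. f s) = (\<Sum>i<m. \<Sum>j<n. f (i * n + j))"
proof -
  have "(\<Sum>i<m. \<Sum>j<n. f (i * n + j)) = (\<Sum>(i, j)\<in>{..<m} \<times> {..<n}. f (i * n + j))"
    by (simp add: sum.cartesian_product)
  also have "\<dots> = (\<Sum>s<m * n. f s)"
    by (rule sum.reindex_bij_witness[where i = "\<lambda>s. (s div n, s mod n)" and j = "\<lambda>(i, j). i * n + j"])
       (auto simp: block_index_less block_index_div_mod)
  finally show ?thesis ..
qed

text \<open>The operator \<open>\<Sum>\<^sub>k R\<^sub>k \<otimes> |k\<rangle>\<langle>k|\<close> on \<open>\<complex>\<^sup>n \<otimes> \<complex>\<^sup>N\<close>.\<close>

definition classical_register :: "nat \<Rightarrow> nat \<Rightarrow> (nat \<Rightarrow> complex mat) \<Rightarrow> complex mat" where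
  "classical_register n N R = mat (n * N) (n * N) (\<lambda>(s, t).
     if s mod N = t mod N then R (s mod N) $$ (s div N, t div N) else 0)"

text \<open>The isometry \<open>x \<mapsto> x \<otimes> e_k\<close>, which places a vector in the
  sector where the register reads \<open>k\<close>.\<close>

definition register_embedding :: "nat \<Rightarrow> nat \<Rightarrow> nat \<Rightarrow> complex mat" where
  "register_embedding n N k = mat (n * N) n (\<lambda>(s, i). if s = i * N + k then 1 else 0)"

lemma classical_register_carrier [simp]: "classical_register n N R \<in> carrier_mat (n * N) (n * N)"
  by (simp add: classical_register_def)

lemma register_embedding_carrier [simp]: "register_embedding n N k \<in> carrier_mat (n * N) n"
  by (simp add: register_embedding_def)

lemma classical_register_hermitian:
  assumes "\<And>k. k < N \<Longrightarrow> R k \<in> carrier_mat n n" "\<And>k. k < N \<Longrightarrow> mat_adjoint (R k) = R k"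
  shows "mat_adjoint (classical_register n N R) = classical_register n N R"
proof (rule eq_matI, goal_cases)
  case (1 s t)
  then have st: "s < n * N" "t < n * N" by (auto simp: classical_register_def)
  note b = block_index_div_mod[OF st(1)] block_index_div_mod[OF st(2)]
  have "mat_adjoint (R (s mod N)) $$ (s div N, t div N) = cnj (R (s mod N) $$ (t div N, s div N))"
    using assms(1)[of "s mod N"] b by simp
  then show ?case using st assms(2)[of "s mod N"] b
    by (cases "s mod N = t mod N") (simp_all add: classical_register_def)
qed (auto simp: classical_register_def)

lemma mult_register_embedding_index:
  assumes X: "X \<in> carrier_mat l (n * N)" and "s < l" "i < n" "k < N"
  shows "(X * register_embedding n N k) $$ (s, i) = X $$ (s, i * N + k)"
  using assms block_index_less[of i n k N]
  by (simp add: register_embedding_def scalar_prod_def if_distrib[of "\<lambda>x. _ * x"] cong: if_cong)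

lemma register_embedding_mult_index:
  assumes Y: "Y \<in> carrier_mat n l" and "s < n * N" "j < l" "k < N"
  shows "(register_embedding n N k * Y) $$ (s, j) = (if s mod N = k then Y $$ (s div N, j) else 0)"
proof -
  have *: "s = i * N + k \<longleftrightarrow> s mod N = k \<and> i = s div N" for i
    using \<open>k < N\<close> by auto
  show ?thesis
    using assms block_index_div_mod[of s n N]
    by (cases "s mod N = k")
       (simp_all add: register_embedding_def scalar_prod_def * if_distrib[of "\<lambda>x. x * _"] cong: if_cong)
qed

text \<open>Each embedding intertwines the register operator with \<open>R k\<close>, hence also
  their logarithms. The diagonal entries of \<open>?S * ?f ?S\<close> in sector \<open>k\<close> are
  therefore those of \<open>R k * ?f (R k)\<close>, and the trace splits into a sum over
  \<open>k\<close>.\<close>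

lemma vn_entropy_classical_register:
  assumes R: "\<And>k. k < N \<Longrightarrow> R k \<in> carrier_mat n n" and hR: "\<And>k. k < N \<Longrightarrow> mat_adjoint (R k) = R k"
  shows "vn_entropy (classical_register n N R) = (\<Sum>k<N. vn_entropy (R k))"
proof -
  let ?S = "classical_register n N R" and ?f = "hermitian_fun (log 2)" and ?V = "register_embedding n N"
  have S: "?S \<in> carrier_mat (n * N) (n * N)" "mat_adjoint ?S = ?S"
    using classical_register_hermitian[OF R hR] by auto
  note fS = hermitian_fun_carrier[OF S, of "log 2"]
  have SV: "?S * ?V k = ?V k * R k" if k: "k < N" for k
  proof (rule eq_matI, goal_cases)
    case (1 s i)
    then have si: "s < n * N" "i < n" using R[OF k] by (auto simp: register_embedding_def)
    show ?case
      using mult_register_embedding_index[OF S(1) si k] register_embedding_mult_index[OF R[OF k] si k]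
        si k block_index_less[OF si(2) k]
      by (simp add: classical_register_def)
  qed (use R[OF k] in \<open>auto simp: register_embedding_def classical_register_def\<close>)
  have block: "(?S * ?f ?S) $$ (i * N + k, i * N + k) = (R k * ?f (R k)) $$ (i, i)"
    if k: "k < N" and i: "i < n" for i k
  proof -
    note fR = hermitian_fun_carrier[OF R[OF k] hR[OF k], of "log 2"]
    have V: "?V k \<in> carrier_mat (n * N) n" by simp
    have fSV: "?f ?S * ?V k = ?V k * ?f (R k)"
      by (rule hermitian_fun_intertwine[OF S R[OF k] hR[OF k] V SV[OF k]])
    have "(?S * ?f ?S) * ?V k = ?V k * (R k * ?f (R k))"
      using assoc_mult_mat[OF S(1) fS V] assoc_mult_mat[OF S(1) V fR] assoc_mult_mat[OF V R[OF k] fR]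
      by (simp add: fSV SV[OF k])
    then show ?thesis
      using mult_register_embedding_index[OF mult_carrier_mat[OF S(1) fS] block_index_less[OF i k] i k]
        register_embedding_mult_index[OF mult_carrier_mat[OF R[OF k] fR] block_index_less[OF i k] i k] i k
      by simp
  qed
  \<comment> \<open>Split each diagonal index into system part \<open>i\<close> and register value
    \<open>k\<close>, then sum over \<open>i\<close> first.\<close>
  have "mat_trace (?S * ?f ?S) = (\<Sum>s<n * N. (?S * ?f ?S) $$ (s, s))"
    by (simp add: mat_trace_def classical_register_def)
  also have "\<dots> = (\<Sum>i<n. \<Sum>k<N. (R k * ?f (R k)) $$ (i, i))"
    by (simp add: sum_block_index block del: index_mult_mat)
  also have "\<dots> = (\<Sum>k<N. \<Sum>i<n. (R k * ?f (R k)) $$ (i, i))"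
    by (rule sum.swap)
  also have "\<dots> = (\<Sum>k<N. mat_trace (R k * ?f (R k)))"
    by (intro sum.cong refl) (use R in \<open>auto simp: mat_trace_def simp del: index_mult_mat(1)\<close>)
  finally show ?thesis by (simp add: vn_entropy_def sum_negf)
qed

section \<open>Partial traces of register operators\<close>

text \<open>The traced index changes only the quotient by \<open>N\<close>; the register value, the
  remainder, is untouched, so the trace acts on each \<open>R k\<close> separately.\<close>

lemma ptrace_register_middle:
  "ptrace a b N (classical_register (a * b) N R) = classical_register a N (\<lambda>k. ptrace a b 1 (R k))"
proof (rule eq_matI, goal_cases)
  case (1 s t)
  then have st: "s < a * N" "t < a * N" by (auto simp: classical_register_def)
  note bs = block_index_div_mod[OF st(1)] and bt = block_index_div_mod[OF st(2)]
  have "(s div N * b + j) * N + s mod N < a * b * N" "(t div N * b + j) * N + t mod N < a * b * N"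
    if "j < b" for j
    using that bs bt by (intro block_index_less; simp)+
  then show ?case
    using st bs bt by (auto simp: ptrace_def classical_register_def)
qed (auto simp: ptrace_def classical_register_def)

lemma ptrace_register_left:
  "ptrace 1 a (b * N) (classical_register (a * b) N R) = classical_register b N (\<lambda>k. ptrace 1 a b (R k))"
proof (rule eq_matI, goal_cases)
  case (1 s t)
  then have st: "s < b * N" "t < b * N" by (auto simp: classical_register_def)
  note bs = block_index_div_mod[OF st(1)] and bt = block_index_div_mod[OF st(2)]
  have N: "N \<noteq> 0" using bs by auto
  \<comment> \<open>Associativity of the tensor product in coordinates: an index of
    \<open>A \<otimes> (B \<otimes> E)\<close> reread as one of
    \<open>(A \<otimes> B) \<otimes> E\<close>.\<close>
  have eq: "j * (b * N) + s = (j * b + s div N) * N + s mod N" for j s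
    by (simp add: algebra_simps)
  have "(j * b + s div N) * N + s mod N < a * b * N" "(j * b + t div N) * N + t mod N < a * b * N"
    if "j < a" for j
    using that bs bt by (intro block_index_less; simp)+
  then show ?case
    using st bs bt N by (auto simp: ptrace_def classical_register_def eq simp del: div_mult_mod_eq)
qed (auto simp: ptrace_def classical_register_def)

text \<open>The case of a trivial second factor in \<open>ptrace_register_left\<close>: what remains
  is the register with 1 by 1 blocks.\<close>

lemma ptrace_register_all:
  "ptrace 1 n N (classical_register n N R) = classical_register 1 N (\<lambda>k. ptrace 1 n 1 (R k))"
  using ptrace_register_left[of n 1 N R] by simp

lemma ptrace_register:
  "ptrace n N 1 (classical_register n N R) = mat n n (\<lambda>ij. \<Sum>k<N. R k $$ ij)"
proof (rule eq_matI, goal_cases)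
  case (1 s t)
  then show ?case
    using block_index_less[of s n _ N] block_index_less[of t n _ N]
    by (simp add: ptrace_def classical_register_def)
qed (auto simp: ptrace_def)

lemma ptrace_smult:
  assumes "M \<in> carrier_mat (l * m * r) (l * m * r)"
  shows "ptrace l m r (c \<cdot>\<^sub>m M) = c \<cdot>\<^sub>m ptrace l m r M"
proof (rule eq_matI, goal_cases)
  case (1 s t)
  then have st: "s < l * r" "t < l * r" by (auto simp: ptrace_def)
  have "(s div r * m + j) * r + s mod r < l * m * r" if "j < m" "s < l * r" for j s
    using that block_index_div_mod[of s l r] by (intro block_index_less)
  then show ?case using st assms by (simp add: ptrace_def sum_distrib_left)
qed (auto simp: ptrace_def)

lemma mat_trace_ptrace:
  assumes "M \<in> carrier_mat (l * m * r) (l * m * r)"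
  shows "mat_trace (ptrace l m r M) = mat_trace M"
proof -
  have "mat_trace (ptrace l m r M) = (\<Sum>i<l. \<Sum>k<r. \<Sum>j<m. M $$ ((i * m + j) * r + k, (i * m + j) * r + k))"
    by (simp add: mat_trace_def ptrace_def sum_block_index block_index_less)
  also have "\<dots> = (\<Sum>i<l. \<Sum>j<m. \<Sum>k<r. M $$ ((i * m + j) * r + k, (i * m + j) * r + k))"
    by (intro sum.cong refl sum.swap)
  also have "\<dots> = mat_trace M"
    using assms by (simp add: mat_trace_def sum_block_index)
  finally show ?thesis .
qed

section \<open>Pure states and their marginals\<close>

lemma ket_bra_carrier [simp]: "v \<in> carrier_vec n \<Longrightarrow> ket_bra v \<in> carrier_mat n n"
  by (simp add: ket_bra_def)

lemma mat_trace_ket_bra: "mat_trace (ket_bra v) = v \<bullet>c v"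
  by (simp add: mat_trace_def ket_bra_def scalar_prod_def lessThan_atLeast0)

lemma ket_bra_eq_mult_adjoint:
  assumes "v \<in> carrier_vec n"
  shows "ket_bra v = mat_of_cols n [v] * mat_adjoint (mat_of_cols n [v])"
  using assms by (intro eq_matI) (auto simp: ket_bra_def scalar_prod_def mat_of_cols_def)

lemma ket_bra_hermitian: "mat_adjoint (ket_bra v) = ket_bra v"
  by (rule eq_matI) (auto simp: ket_bra_def)

lemma vn_entropy_one: "vn_entropy (1\<^sub>m n) = 0"
  using vn_entropy_diag[OF is_unitary_one[of n], of "1\<^sub>m n" "\<lambda>_. 1"] is_unitaryD[OF is_unitary_one[of n]] by simp

text \<open>With \<open>v\<close> as a one-column matrix, exchanging the factors in
  \<open>vn_entropy_mult_adjoint\<close> turns the projector into the 1 by 1 identity.\<close>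

lemma vn_entropy_ket_bra:
  assumes v: "v \<in> carrier_vec n" "v \<bullet>c v = 1"
  shows "vn_entropy (ket_bra v) = 0"
proof -
  let ?C = "mat_of_cols n [v]"
  have C: "?C \<in> carrier_mat n 1" by auto
  have "conjugate v \<bullet> v = 1" using v conjugate_vec_sprod_comm[of v n v] by simp
  then have "mat_adjoint ?C * ?C = 1\<^sub>m 1"
    using v by (intro eq_matI) (auto simp: mat_adjoint_def)
  then show ?thesis
    using vn_entropy_mult_adjoint[OF C] ket_bra_eq_mult_adjoint[OF v(1)] by (simp add: vn_entropy_one)
qed

text \<open>The coefficients of \<open>v\<close> in the product basis, arranged as an
  \<open>a\<close> by \<open>b\<close> matrix M. With M^H its adjoint, the two marginals of
  \<open>ket_bra v\<close> are M M^H and the transpose of M^H M.\<close>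

definition coeff_mat :: "nat \<Rightarrow> nat \<Rightarrow> complex vec \<Rightarrow> complex mat" where
  "coeff_mat a b v = mat a b (\<lambda>(x, y). v $ (x * b + y))"

lemma coeff_mat_carrier [simp]: "coeff_mat a b v \<in> carrier_mat a b"
  by (simp add: coeff_mat_def)

lemma ptrace_right_ket_bra:
  assumes "v \<in> carrier_vec (a * b)"
  shows "ptrace a b 1 (ket_bra v) = coeff_mat a b v * mat_adjoint (coeff_mat a b v)"
  using assms
  by (intro eq_matI) (auto simp: ptrace_def coeff_mat_def ket_bra_def scalar_prod_def lessThan_atLeast0 block_index_less)

lemma ptrace_left_ket_bra:
  assumes "v \<in> carrier_vec (a * b)"
  shows "ptrace 1 a b (ket_bra v) = transpose_mat (mat_adjoint (coeff_mat a b v) * coeff_mat a b v)"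
  using assms
  by (intro eq_matI)
     (auto simp: ptrace_def coeff_mat_def ket_bra_def scalar_prod_def lessThan_atLeast0 block_index_less mult.commute)

lemma ptrace_ket_bra_hermitian:
  assumes v: "v \<in> carrier_vec (a * b)"
  shows "mat_adjoint (ptrace a b 1 (ket_bra v)) = ptrace a b 1 (ket_bra v)"
    and "mat_adjoint (ptrace 1 a b (ket_bra v)) = ptrace 1 a b (ket_bra v)"
proof -
  show "mat_adjoint (ptrace a b 1 (ket_bra v)) = ptrace a b 1 (ket_bra v)"
    unfolding ptrace_right_ket_bra[OF v] by (rule adjoint_mult_self_hermitian[OF coeff_mat_carrier])
  show "mat_adjoint (ptrace 1 a b (ket_bra v)) = ptrace 1 a b (ket_bra v)"
    using v
    by (intro eq_matI) (auto simp: ptrace_def ket_bra_def block_index_less mult.commute)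
qed

text \<open>Neither exchanging the factors M and M^H nor transposing changes the entropy, so no
  Schmidt decomposition is required.\<close>

lemma vn_entropy_pure_marginals:
  assumes v: "v \<in> carrier_vec (a * b)"
  shows "vn_entropy (ptrace 1 a b (ket_bra v)) = vn_entropy (ptrace a b 1 (ket_bra v))"
proof -
  let ?M = "coeff_mat a b v"
  have M: "?M \<in> carrier_mat a b" "mat_adjoint ?M \<in> carrier_mat b a" by auto
  have "mat_adjoint (mat_adjoint ?M * ?M) = mat_adjoint ?M * ?M"
    using adjoint_mult_self_hermitian[OF M(2)] by simp
  then show ?thesis
    unfolding ptrace_right_ket_bra[OF v] ptrace_left_ket_bra[OF v] vn_entropy_mult_adjoint[OF M(1)]
    by (rule vn_entropy_transpose[OF mult_carrier_mat[OF M(2,1)]])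
qed

text \<open>Moving \<open>W\<close> across the inner product leaves the squared norm of
  \<open>mat_adjoint W *\<^sub>v v\<close>.\<close>

lemma mult_adjoint_psd:
  fixes W :: "complex mat"
  assumes W: "W \<in> carrier_mat n m" and v: "v \<in> carrier_vec n"
  shows "0 \<le> ((W * mat_adjoint W) *\<^sub>v v) \<bullet>c v"
proof -
  have Ws: "mat_adjoint W \<in> carrier_mat m n" using W by simp
  have "((W * mat_adjoint W) *\<^sub>v v) \<bullet>c v = (mat_adjoint W *\<^sub>v v) \<bullet>c (mat_adjoint W *\<^sub>v v)"
    using mult_mat_vec_cscalar_prod[OF W mult_mat_vec_carrier[OF Ws v] v] assoc_mult_mat_vec[OF W Ws v] by simp
  then show ?thesis by auto
qed

section \<open>The extension obtained from a pure-state ensemble\<close>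

text \<open>Hermiticity and positivity both come from a factorization of the operator as
  \<open>W * mat_adjoint W\<close>; the trace is the sum of the weights.\<close>

lemma is_state_ensemble_register:
  assumes "is_pure_ensemble n N p \<Psi> \<rho>"
  shows "is_state (n * N) (classical_register n N (\<lambda>k. complex_of_real (p k) \<cdot>\<^sub>m ket_bra (\<Psi> k)))"
    (is "is_state _ ?S")
proof -
  from assms have p: "\<And>k. k < N \<Longrightarrow> 0 \<le> p k" and \<Psi>: "\<And>k. k < N \<Longrightarrow> \<Psi> k \<in> carrier_vec n"
    and nrm: "\<And>k. k < N \<Longrightarrow> \<Psi> k \<bullet>c \<Psi> k = 1" and p1: "(\<Sum>k<N. p k) = 1"
    by (auto simp: is_pure_ensemble_def)
  \<comment> \<open>Column \<open>k\<close> of \<open>W\<close> is the vector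
    \<open>sqrt (p k) * \<Psi> k \<otimes> e_k\<close>.\<close>
  define W where "W = mat (n * N) N (\<lambda>(s, k).
    if s mod N = k then complex_of_real (sqrt (p k)) * \<Psi> k $ (s div N) else 0)"
  have W: "W \<in> carrier_mat (n * N) N" by (simp add: W_def)
  have S: "?S = W * mat_adjoint W"
  proof (rule eq_matI, goal_cases)
    case (1 s t)
    then have st: "s < n * N" "t < n * N" by (auto simp: W_def)
    note bs = block_index_div_mod[OF st(1)] and bt = block_index_div_mod[OF st(2)]
    have sq: "complex_of_real (sqrt (p k)) * x * (complex_of_real (sqrt (p k)) * y) = complex_of_real (p k) * (x * y)"
      if "k < N" for k x y
    proof -
      have "complex_of_real (sqrt (p k)) * x * (complex_of_real (sqrt (p k)) * y) =
        complex_of_real (sqrt (p k) * sqrt (p k)) * (x * y)"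
        by (simp only: of_real_mult ac_simps)
      then show ?thesis using p[OF that] by simp
    qed
    have "(W * mat_adjoint W) $$ (s, t) = (\<Sum>k<N. W $$ (s, k) * cnj (W $$ (t, k)))"
      using st W by (simp add: scalar_prod_def lessThan_atLeast0)
    \<comment> \<open>Row \<open>s\<close> of \<open>W\<close> is supported in column
      \<open>s mod N\<close> only. If \<open>t mod N\<close> differs, that term vanishes as well,
      matching the zero off-diagonal entry of \<open>?S\<close>.\<close>
    also have "\<dots> = (\<Sum>k<N. if s mod N = k then ?S $$ (s, t) else 0)"
    proof (rule sum.cong, goal_cases)
      case (2 k)
      then show ?case
        using st bs bt \<Psi>[of k] by (auto simp: W_def classical_register_def ket_bra_def sq)
    qed simp
    also have "\<dots> = ?S $$ (s, t)" using bs by simp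
    finally show ?case ..
  qed (auto simp: W_def classical_register_def)
  have "mat_trace ?S = (\<Sum>s<n * N. ?S $$ (s, s))"
    by (simp add: mat_trace_def classical_register_def)
  also have "\<dots> = (\<Sum>i<n. \<Sum>k<N. complex_of_real (p k) * ket_bra (\<Psi> k) $$ (i, i))"
    unfolding sum_block_index
    using carrier_vecD[OF \<Psi>] by (intro sum.cong refl) (auto simp: classical_register_def block_index_less ket_bra_def)
  also have "\<dots> = (\<Sum>k<N. \<Sum>i<n. complex_of_real (p k) * ket_bra (\<Psi> k) $$ (i, i))"
    by (rule sum.swap)
  also have "\<dots> = (\<Sum>k<N. complex_of_real (p k) * mat_trace (ket_bra (\<Psi> k)))"
    by (intro sum.cong refl) (use carrier_vecD[OF \<Psi>] in \<open>auto simp: mat_trace_def sum_distrib_left ket_bra_def\<close>)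
  also have "\<dots> = complex_of_real (\<Sum>k<N. p k)"
    by (simp add: mat_trace_ket_bra nrm)
  finally have "mat_trace ?S = 1" using p1 by simp
  moreover have "mat_adjoint ?S = ?S" unfolding S by (rule adjoint_mult_self_hermitian[OF W])
  moreover have "0 \<le> (?S *\<^sub>v v) \<bullet>c v" if "v \<in> carrier_vec (n * N)" for v
    unfolding S by (rule mult_adjoint_psd[OF W that])
  ultimately show ?thesis by (simp add: is_state_def)
qed

text \<open>AE and BE each contribute the average entanglement entropy, ABE and E contribute no
  average term, and the four Shannon terms cancel. This gives the factor 2.\<close>

lemma cond_mutual_info_ensemble_register:
  assumes "is_pure_ensemble (a * b) N p \<Psi> \<rho>"
  shows "cond_mutual_info a b N
      (classical_register (a * b) N (\<lambda>k. complex_of_real (p k) \<cdot>\<^sub>m ket_bra (\<Psi> k))) =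
    2 * (\<Sum>k<N. p k * vn_entropy (ptrace a b 1 (ket_bra (\<Psi> k))))"
proof -
  from assms have \<Psi>: "\<And>k. k < N \<Longrightarrow> \<Psi> k \<in> carrier_vec (a * b)"
    and nrm: "\<And>k. k < N \<Longrightarrow> \<Psi> k \<bullet>c \<Psi> k = 1" by (auto simp: is_pure_ensemble_def)
  \<comment> \<open>A form common to all four entropies: \<open>X k\<close> is the normalized
    conditional operator given register value \<open>k\<close>, and the subtracted sum depends on
    the weights alone.\<close>
  have entropy: "vn_entropy (classical_register n N R) =
      (\<Sum>k<N. p k * vn_entropy (X k)) - (\<Sum>k<N. p k * log 2 (p k))"
    if X: "\<And>k. k < N \<Longrightarrow> X k \<in> carrier_mat n n \<and> mat_adjoint (X k) = X k \<and> mat_trace (X k) = 1"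
      and R: "\<And>k. k < N \<Longrightarrow> R k = complex_of_real (p k) \<cdot>\<^sub>m X k" for n X R
  proof -
    have "mat_adjoint (R k) = R k" if k: "k < N" for k
    proof -
      have "mat_adjoint (complex_of_real (p k) \<cdot>\<^sub>m X k) = complex_of_real (p k) \<cdot>\<^sub>m mat_adjoint (X k)"
        by (rule eq_matI) auto
      then show ?thesis using X[OF k] R[OF k] by simp
    qed
    then have "vn_entropy (classical_register n N R) = (\<Sum>k<N. vn_entropy (R k))"
      using X R by (intro vn_entropy_classical_register) auto
    also have "\<dots> = (\<Sum>k<N. p k * vn_entropy (X k) - p k * log 2 (p k))"
      by (rule sum.cong) (use X R in \<open>auto simp: vn_entropy_smult[of _ n]\<close>)
    finally show ?thesis by (simp add: sum_subtractf)
  qed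
  have K: "ket_bra (\<Psi> k) \<in> carrier_mat (a * b) (a * b)" "mat_trace (ket_bra (\<Psi> k)) = 1" if "k < N" for k
    using \<Psi> nrm that by (auto simp: mat_trace_ket_bra)
  have pt: "ptrace l m r M \<in> carrier_mat (l * r) (l * r)" for l m r M by (simp add: ptrace_def)
  let ?H = "\<Sum>k<N. p k * log 2 (p k)"
  let ?K = "\<lambda>k. ket_bra (\<Psi> k)"
  let ?S = "classical_register (a * b) N (\<lambda>k. complex_of_real (p k) \<cdot>\<^sub>m ?K k)"
  have ABE: "vn_entropy ?S = - ?H"
    by (subst entropy[of ?K]) (use K ket_bra_hermitian \<Psi> nrm in \<open>auto simp: vn_entropy_ket_bra[of _ "a * b"]\<close>)
  have AE: "vn_entropy (ptrace a b N ?S) = (\<Sum>k<N. p k * vn_entropy (ptrace a b 1 (?K k))) - ?H"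
    unfolding ptrace_register_middle
    by (rule entropy)
      (use K pt[of a b 1] ptrace_ket_bra_hermitian(1)[OF \<Psi>] in \<open>auto simp: mat_trace_ptrace ptrace_smult\<close>)
  have "vn_entropy (ptrace 1 a (b * N) ?S) = (\<Sum>k<N. p k * vn_entropy (ptrace 1 a b (?K k))) - ?H"
    unfolding ptrace_register_left
    by (rule entropy)
      (use K pt[of 1 a b] ptrace_ket_bra_hermitian(2)[OF \<Psi>] in \<open>auto simp: mat_trace_ptrace ptrace_smult\<close>)
  then have BE: "vn_entropy (ptrace 1 a (b * N) ?S) = (\<Sum>k<N. p k * vn_entropy (ptrace a b 1 (?K k))) - ?H"
    using vn_entropy_pure_marginals[OF \<Psi>] by simp
  have one: "ptrace 1 (a * b) 1 (?K k) = 1\<^sub>m 1" if "k < N" for k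
  proof (rule eq_matI, goal_cases)
    case (1 i j)
    then show ?case using K[OF that] by (simp add: ptrace_def mat_trace_def)
  qed (auto simp: ptrace_def)
  \<comment> \<open>Given \<open>k\<close>, nothing but the trace of the pure state is left, so
    every conditional operator is the 1 by 1 identity, of entropy 0.\<close>
  have E: "vn_entropy (ptrace 1 (a * b) N ?S) = - ?H"
    unfolding ptrace_register_all
    by (subst entropy[of "\<lambda>_. 1\<^sub>m 1"])
       (use K one is_unitaryD[OF is_unitary_one[of 1]] in \<open>auto simp: vn_entropy_one ptrace_smult mat_trace_def\<close>)
  show ?thesis unfolding cond_mutual_info_def ABE AE BE E by simp
qed

theorem proposition5:
  fixes a b :: nat and \<rho> :: "complex mat"
  assumes "is_state (a * b) \<rho>"
  shows "squashed_entanglement a b \<rho> \<le> entanglement_of_formation a b \<rho>"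
  unfolding entanglement_of_formation_def
proof (rule Inf_greatest)
  fix x
  assume "x \<in> {ereal (\<Sum>k<N. p k * vn_entropy (ptrace a b 1 (ket_bra (\<Psi> k)))) | N p \<Psi>.
    is_pure_ensemble (a * b) N p \<Psi> \<rho>}"
  then obtain N p \<Psi> where x: "x = ereal (\<Sum>k<N. p k * vn_entropy (ptrace a b 1 (ket_bra (\<Psi> k))))"
    and ens: "is_pure_ensemble (a * b) N p \<Psi> \<rho>" by blast
  \<comment> \<open>This extension, with \<open>E\<close> of dimension \<open>N\<close>, attains
    exactly the ensemble average \<open>x\<close>, which therefore lies in the set whose infimum is
    the squashed entanglement.\<close>
  let ?S = "classical_register (a * b) N (\<lambda>k. complex_of_real (p k) \<cdot>\<^sub>m ket_bra (\<Psi> k))"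
  have dim: "dim_vec (\<Psi> k) = a * b" if "k < N" for k
    using ens that by (auto simp: is_pure_ensemble_def)
  have "ptrace (a * b) N 1 ?S = mat (a * b) (a * b) (\<lambda>ij. \<Sum>k<N. complex_of_real (p k) * ket_bra (\<Psi> k) $$ ij)"
    unfolding ptrace_register using dim
    by (intro eq_matI) (auto simp: ket_bra_def intro!: sum.cong)
  then have "ptrace (a * b) N 1 ?S = \<rho>" using ens by (simp add: is_pure_ensemble_def)
  moreover have "x = ereal (1 / 2 * cond_mutual_info a b N ?S)"
    unfolding x cond_mutual_info_ensemble_register[OF ens] by simp
  ultimately show "squashed_entanglement a b \<rho> \<le> x"
    unfolding squashed_entanglement_def
    using is_state_ensemble_register[OF ens] by (intro Inf_lower) blast
qed

end
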